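(* Let $q$ be a prime power, let $\mathbb{F}_q$ be the field with $q$ elements, and let $n$ be a positive integer. The standard action of $\mathrm{PGL}_n(\mathbb{F}_q)$ on the projective space $\mathbb{P}^{n-1}(\mathbb{F}_q)$ has the weak EKR property. Moreover, when $\gcd(n,q-1)=1$, the action of $\mathrm{PSL}_n(\mathbb{F}_q)$ on $\mathbb{P}^{n-1}(\mathbb{F}_q)$ has the weak EKR property.
   Context: Let a finite group $G$ act transitively on a finite set $X$. A subset $S\subseteq G$ is called intersecting (for this action) if for all $g,h\in S$ there exists $x\in X$ with $g\cdot x=h\cdot x$. The action has the weak EKR property if every intersecting set $S\subseteq G$ satisfies $|S|\le |G|/|X|$. Here $\mathbb{P}^{n-1}(\mathbb{F}_q)$ is the set of one-dimensional subspaces of $\mathbb{F}_q^n$, with the action induced by the linear action of $\mathrm{GL}_n(\mathbb{F}_q)$ (respectively $\mathrm{SL}_n(\mathbb{F}_q)$) on $\mathbb{F}_q^n$. *)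

theory Defs
  imports
    "HOL-Analysis.Analysis"
    "HOL-Algebra.Group_Action"
    "HOL-Number_Theory.Prime_Powers"
begin

definition intersecting ::
    "('g, 'm) monoid_scheme \<Rightarrow> 'x set \<Rightarrow> ('g \<Rightarrow> 'x \<Rightarrow> 'x) \<Rightarrow> 'g set \<Rightarrow> bool" where
  "intersecting G X \<phi> S \<longleftrightarrow>
     S \<subseteq> carrier G \<and> (\<forall>g\<in>S. \<forall>h\<in>S. \<exists>x\<in>X. \<phi> g x = \<phi> h x)"

text \<open>The weak EKR property is only meaningful for a transitive action of a finite group on a
  finite set, so these requirements are part of the predicate.\<close>

definition weak_EKR ::
    "('g, 'm) monoid_scheme \<Rightarrow> 'x set \<Rightarrow> ('g \<Rightarrow> 'x \<Rightarrow> 'x) \<Rightarrow> bool" where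
  "weak_EKR G X \<phi> \<longleftrightarrow>
     finite (carrier G) \<and> finite X \<and> transitive_action G X \<phi> \<and>
     (\<forall>S. intersecting G X \<phi> S \<longrightarrow> real (card S) \<le> real (order G) / real (card X))"

definition GL :: "('a::field ^ 'n ^ 'n) monoid" where
  "GL = \<lparr>carrier = {A. invertible A}, monoid.mult = (**), one = mat 1\<rparr>"

definition SL :: "('a::field ^ 'n ^ 'n) monoid" where
  "SL = GL\<lparr>carrier := {A \<in> carrier GL. det A = 1}\<rparr>"

definition scalars :: "('a::field ^ 'n ^ 'n) set" where
  "scalars = {mat c | c. c \<noteq> 0}"

definition PGL :: "('a::field ^ 'n ^ 'n) set monoid" where
  "PGL = GL Mod scalars"

definition PSL :: "('a::field ^ 'n ^ 'n) set monoid" where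
  "PSL = SL Mod (scalars \<inter> carrier SL)"

definition proj_space :: "('a::field ^ 'n) set set" where
  "proj_space = {V. vec.subspace V \<and> vec.dim V = 1}"

text \<open>Elements of \<open>PGL\<close> and \<open>PSL\<close> are cosets \<open>C\<close> of scalar matrices; all \<open>A \<in> C\<close> have the same
  image \<open>A V\<close>, which \<open>the_elem\<close> selects.  The restriction to \<open>proj_space\<close> makes the action map
  into \<open>BijGroup proj_space\<close>, whose elements are extensional functions.\<close>

definition proj_action ::
    "('a::field ^ 'n ^ 'n) set \<Rightarrow> ('a ^ 'n) set \<Rightarrow> ('a ^ 'n) set" where
  "proj_action C = (\<lambda>V\<in>proj_space. the_elem ((\<lambda>A. (*v) A ` V) ` C))"

end

theory Submission
  imports Defs "HOL-Algebra.Algebraic_Closure_Type"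
begin

text \<open>
  Identify \<open>'a ^ 'n\<close> with the extension field \<open>F\<close> of degree \<open>n\<close>. Multiplications by nonzero elements
  of \<open>F\<close> are linear, and two of them that agree on a line are proportional, so their classes form a
  sharply transitive set \<open>R\<close> of projectivities (a Singer cycle). If \<open>S\<close> is intersecting, the products
  \<open>s r\<close> with \<open>s \<in> S\<close> and \<open>r \<in> R\<close> are pairwise distinct, hence \<open>|S| |X| = |S| |R| \<le> |G|\<close>. When
  \<open>n\<close> is coprime to \<open>q - 1\<close>, every element of the field with \<open>q\<close> elements is an \<open>n\<close>-th power, so each
  invertible matrix has a scalar multiple of determinant 1 and the argument descends to \<open>PSL\<close>.
\<close>

section \<open>The extension field of degree n\<close>

text \<open>Over an algebraically closed field \<open>p\<close> splits into linear factors, and the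
  multiset of roots of such a product can be read off by induction over the factors.\<close>

lemma size_proots_alg_closed:
  fixes p :: "'k::alg_closed_field poly"
  shows "size (proots p) = Polynomial.degree p"
proof (cases "p = 0")
  case False
  then obtain A where A: "size A = Polynomial.degree p"
      "p = Polynomial.smult (Polynomial.lead_coeff p) (\<Prod>x\<in>#A. [:-x, 1:])"
    using alg_closed_imp_factorization by blast
  have "proots p = proots (\<Prod>x\<in>#A. [:-x, 1:])"
    using False by (subst A(2)) simp
  also have "\<dots> = A"
  proof (induction A)
    case (add x A)
    have "(\<Prod>y\<in>#A. [:-y, 1:]) \<noteq> 0" by auto
    hence "proots ([:-x, 1:] * (\<Prod>y\<in>#A. [:-y, 1:])) = add_mset x A"
      using add by (subst proots_mult) auto
    thus ?case by simp
  qed simp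
  finally show ?thesis using A(1) by simp
qed simp

text \<open>The fixed points are the roots of X^m - X. The characteristic divides m, so the
  derivative is -1; all roots are therefore simple and their number is the degree m.\<close>

lemma card_Frobenius_fixed_points:
  fixes m k :: nat
  assumes "Factorial_Ring.prime CHAR('k::alg_closed_field)" and m: "m = CHAR('k) ^ k" and "k > 0"
  shows "card {x::'k. x ^ m = x} = m"
proof -
  have m1: "m > 1"
    unfolding m using assms prime_gt_1_nat one_less_power by blast
  define P :: "'k poly" where "P = Polynomial.monom 1 m - Polynomial.monom 1 1"
  have coeff: "Polynomial.coeff P m = 1" using m1 by (simp add: P_def)
  have deg: "Polynomial.degree P = m"
  proof (rule antisym)
    show "Polynomial.degree P \<le> m" using m1 unfolding P_def 
      by (intro degree_diff_le degree_monom_le order.trans[OF degree_monom_le]) auto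
    show "m \<le> Polynomial.degree P" using coeff by (intro le_degree) auto
  qed
  have "P \<noteq> 0" using coeff by auto
  have root: "poly P x = 0 \<longleftrightarrow> x ^ m = x" for x
    by (simp add: P_def poly_monom)
  have "of_nat m = (0::'k)" using assms by simp
  hence "pderiv P = - 1" by (simp add: P_def pderiv_diff pderiv_monom one_pCons monom_0)
  \<comment> \<open>A repeated root of \<open>P\<close> would also be a root of
    \<open>pderiv P\<close>, which is the constant -1.\<close>
  have "count (proots P) x \<le> 1" for x
  proof (rule ccontr)
    assume "\<not> count (proots P) x \<le> 1"
    hence "2 \<le> Polynomial.order x P"
      using \<open>P \<noteq> 0\<close> by simp
    hence "[:-x, 1:] ^ 2 dvd P"
      by (simp only: order_divides simp_thms)
    then obtain Q where "P = [:-x, 1:] ^ 2 * Q" by (elim dvdE)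
    hence "P = [:-x, 1:] * ([:-x, 1:] * Q)"
      by (simp only: power2_eq_square mult.assoc)
    hence "pderiv P = [:-x, 1:] * pderiv ([:-x, 1:] * Q) + [:-x, 1:] * Q * pderiv [:-x, 1:]"
      by (simp only: pderiv_mult)
    hence "poly (pderiv P) x = 0"
      by (simp only: poly_add poly_mult) simp
    thus False using \<open>pderiv P = - 1\<close> by simp
  qed
  moreover have "count (proots P) x \<ge> 1" if "x \<in># proots P" for x
    using count_greater_zero_iff[of "proots P" x] that by linarith
  ultimately have "\<forall>x\<in>#proots P. count (proots P) x = 1"
    using le_antisym by blast
  hence "size (proots P) = card (set_mset (proots P))"
    unfolding size_multiset_overloaded_eq by simp
  also have "set_mset (proots P) = {x. x ^ m = x}"
    using \<open>P \<noteq> 0\<close> by (simp add: root)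
  finally show ?thesis by (simp add: size_proots_alg_closed deg)
qed

text \<open>Translation by 1 permutes the field, so adding 1 to each element leaves the sum of all
  elements unchanged. Hence q times 1 vanishes, and the characteristic must be the prime of which q
  is a power.\<close>

lemma card_finite_field_power_CHAR:
  assumes "primepow CARD('a::{field,finite})"
  obtains k where "k > 0" "CARD('a) = CHAR('a) ^ k"
proof -
  obtain p k where pk: "Factorial_Ring.prime p" "k > 0" "CARD('a) = p ^ k"
    using assms by (auto simp: primepow_def)
  have "(\<Sum>x\<in>UNIV. x::'a) = (\<Sum>x\<in>UNIV. x + 1)"
    by (rule sum.reindex_bij_witness[of _ "\<lambda>x. x + 1" "\<lambda>x. x - 1"]) auto
  hence "of_nat CARD('a) = (0::'a)" by (simp add: sum.distrib)
  hence "CHAR('a) dvd p" using pk by (auto simp: of_nat_eq_0_iff_char_dvd)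
  hence "CHAR('a) = p" using pk(1) CHAR_not_1'[where 'a='a] prime_nat_iff[of p] by auto
  thus thesis using that pk by auto
qed

text \<open>Vectors of the span correspond to their coefficient families. Taking these in
  \<open>B \<rightarrow>\<^sub>E UNIV\<close> pins down the values off \<open>B\<close>, which makes
  the correspondence a bijection.\<close>

lemma (in vector_space) card_span_finite_field:
  assumes "independent B" and "finite B"
  shows "card (span B) = CARD('a) ^ card B"
proof -
  define G where "G f = (\<Sum>b\<in>B. f b *s b)" for f
  have "bij_betw G (B \<rightarrow>\<^sub>E UNIV) (span B)"
  proof (rule bij_betw_imageI)
    show "inj_on G (B \<rightarrow>\<^sub>E UNIV)"
    proof (rule inj_onI)
      fix f g assume fg: "f \<in> B \<rightarrow>\<^sub>E UNIV" "g \<in> B \<rightarrow>\<^sub>E UNIV" "G f = G g"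
      have "(\<Sum>b\<in>B. (f b - g b) *s b) = 0"
        using fg(3) by (simp add: G_def scale_left_diff_distrib sum_subtractf)
      hence "f b - g b = 0" if "b \<in> B" for b
        using independentD[OF assms(1,2) order.refl, of "\<lambda>b. f b - g b"] that by blast
      thus "f = g" using fg(1,2) by (intro PiE_ext) auto
    qed
    show "G ` (B \<rightarrow>\<^sub>E UNIV) = span B"
    proof (intro equalityI subsetI)
      fix x assume "x \<in> span B"
      then obtain f where "x = G f"
        unfolding span_finite[OF assms(2)] by (auto simp: G_def)
      moreover have "G f = G (restrict f B)"
        by (simp add: G_def)
      ultimately show "x \<in> G ` (B \<rightarrow>\<^sub>E UNIV)" by auto
    next
      fix x assume "x \<in> G ` (B \<rightarrow>\<^sub>E UNIV)"
      then obtain f where "x = G f" by blast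
      thus "x \<in> span B"
        unfolding G_def by (simp add: span_sum span_scale span_base)
    qed
  qed
  thus ?thesis
    using assms(2) by (simp add: bij_betw_same_card[symmetric] card_PiE)
qed

lemma vector_space_alg_closure:
  "vector_space (\<lambda>(c::'a::field) x. to_ac c * x)"
  by unfold_locales (auto simp: algebra_simps)

text \<open>Multiplication by \<open>c\<close> permutes the nonzero elements; comparing the products
  over them and cancelling gives the claim.\<close>

lemma power_CARD_minus_1_eq_1:
  fixes c :: "'a::{field,finite}"
  assumes "c \<noteq> 0"
  shows "c ^ (CARD('a) - 1) = 1"
proof -
  have "(\<Prod>y\<in>UNIV-{0}. c * y) = (\<Prod>y\<in>UNIV-{0}. y)"
    by (rule prod.reindex_bij_witness[of _ "\<lambda>y. y / c" "\<lambda>y. c * y"]) (use assms in auto)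
  thus ?thesis by (simp add: prod.distrib)
qed

lemma power_CARD_power_eq_same:
  fixes c :: "'a::{field,finite}"
  shows "c ^ (CARD('a) ^ j) = c"
proof (induction j)
  case (Suc j)
  have "c ^ CARD('a) = c"
    by (cases "c = 0")
      (simp, metis power_CARD_minus_1_eq_1 mult.left_neutral power_minus_mult zero_less_card_finite)
  thus ?case using Suc by (simp add: power_mult)
qed simp

text \<open>The extension of degree n is realised inside the algebraic closure as the fixed set of x
  -> x^(q^n). It is a vector space over the base field with q^n elements, hence of dimension n, and
  \<open>T\<close> forms linear combinations of a basis. Describing the range by an equation makes
  its closure under multiplication immediate.\<close>

lemma vec_iso_extension_field:
  assumes "primepow CARD('a::{field,finite})"
  obtains T :: "'a::{field,finite} ^ 'n::finite \<Rightarrow> 'a alg_closure"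
  where "\<And>u v. T (u + v) = T u + T v" and "\<And>c v. T (c *s v) = to_ac c * T v" and "inj T"
    and "range T = {x. x ^ (CARD('a) ^ CARD('n)) = x}"
proof -
  interpret K: vector_space "\<lambda>(c::'a) (x::'a alg_closure). to_ac c * x"
    by (rule vector_space_alg_closure)
  define m where "m = CARD('a) ^ CARD('n)"
  define F where "F = {x::'a alg_closure. x ^ m = x}"
  obtain k where k: "k > 0" "CARD('a) = CHAR('a) ^ k"
    using card_finite_field_power_CHAR assms by blast
  \<comment> \<open>Being a power of the characteristic, \<open>m\<close> is an exponent for which
    powering is additive, and the count of fixed points applies.\<close>
  have m: "m = CHAR('a alg_closure) ^ (k * CARD('n))"
    by (simp add: m_def k(2) power_mult)
  have "CHAR('a) > 0" by (intro finite_imp_CHAR_pos) simp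
  hence prime: "Factorial_Ring.prime CHAR('a alg_closure)"
    using prime_CHAR_semidom[where 'a = 'a] by simp
  have card_F: "card F = CARD('a) ^ CARD('n)"
    unfolding F_def m_def[symmetric] using k(1)
    by (intro card_Frobenius_fixed_points[OF prime m]) simp
  hence "finite F" by (intro card_ge_0_finite) simp
  have fixed: "c ^ CARD('a) ^ j = c" for c :: 'a and j
    by (rule power_CARD_power_eq_same)
  have "K.subspace F"
  proof (rule K.subspaceI)
    show "0 \<in> F" by (simp add: F_def m_def)
    show "x + y \<in> F" if "x \<in> F" "y \<in> F" for x y
      using that freshmans_dream'[OF prime m, of x y] by (simp add: F_def)
    show "to_ac c * x \<in> F" if "x \<in> F" for c x
    proof -
      have "(to_ac c) ^ m = to_ac (c ^ m)" by simp
      thus ?thesis using that fixed[of c] by (simp add: F_def power_mult_distrib m_def)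
    qed
  qed
  obtain B where B: "B \<subseteq> F" "K.independent B" "F \<subseteq> K.span B"
    using K.maximal_independent_subset by blast
  have span: "K.span B = F"
    using B \<open>K.subspace F\<close> by (simp add: K.span_minimal subset_antisym)
  have "finite B" using B(1) \<open>finite F\<close> finite_subset by blast
  \<comment> \<open>A base greater than 1 lets the exponents be compared in q^(card B) =
    q^n.\<close>
  have "CARD('a) > 1" using assms primepow_gt_Suc_0 by auto
  hence "card B = CARD('n)"
    using K.card_span_finite_field[OF B(2) \<open>finite B\<close>] card_F span by simp
  then obtain e where e: "bij_betw e (UNIV :: 'n set) B"
    using \<open>finite B\<close> by (metis finite finite_same_card_bij)
  define T where "T v = (\<Sum>i\<in>UNIV. to_ac (v $ i) * e i)" for v :: "'a ^ 'n"
  have range: "range T = F"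
  proof (intro equalityI subsetI)
    fix x assume "x \<in> range T"
    then obtain v where v: "x = T v" by blast
    have "e i \<in> K.span B" for i
      using e by (auto intro!: K.span_base simp: bij_betw_def)
    hence "T v \<in> K.span B"
      unfolding T_def by (intro K.span_sum K.span_scale)
    thus "x \<in> F" by (simp add: span v)
  next
    fix x assume "x \<in> F"
    then obtain f where "x = (\<Sum>b\<in>B. to_ac (f b) * b)"
      unfolding span[symmetric] K.span_finite[OF \<open>finite B\<close>] by auto
    also have "\<dots> = T (\<chi> i. f (e i))"
      unfolding T_def using sum.reindex_bij_betw[OF e, of "\<lambda>b. to_ac (f b) * b"] by simp
    finally show "x \<in> range T" by simp
  qed
  show thesis
  proof (rule that[of T])
    \<comment> \<open>The domain is finite and the range has the same number of elements.\<close>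
    show "inj T"
      by (rule eq_card_imp_inj_on) (simp_all add: range card_F CARD_vec)
    show "range T = {x. x ^ (CARD('a) ^ CARD('n)) = x}"
      using range by (simp add: F_def m_def)
    show "T (u + v) = T u + T v" for u v
      by (simp add: T_def distrib_right sum.distrib)
    show "T (c *s v) = to_ac c * T v" for c v
      by (simp only: T_def sum_distrib_left vector_smult_component to_ac_mult mult.assoc)
  qed
qed

section \<open>Scalar matrices and the projective space\<close>

lemma mat_mult_left: "mat c ** A = (\<chi> i j. c * A $ i $ j)"
  for A :: "'a::comm_semiring_1 ^ 'm ^ 'n"
  unfolding matrix_matrix_mult_def mat_def
  by (auto simp: if_distrib if_distribR sum.delta'[OF finite] cong: if_cong)

lemma mat_mult_right: "A ** mat c = mat c ** A"
  for A :: "'a::comm_semiring_1 ^ 'n ^ 'n"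
  unfolding mat_mult_left unfolding matrix_matrix_mult_def mat_def
  by (auto simp: if_distrib if_distribR sum.delta'[OF finite] mult.commute cong: if_cong)

lemma mat_mult_mv: "(mat c ** A) *v v = c *s (A *v v)"
  for A :: "'a::comm_semiring_1 ^ 'n ^ 'm"
  unfolding mat_mult_left by (simp add: vec_eq_iff matrix_vector_mult_def sum_distrib_left mult.assoc)

lemma mat_mult_mat: "mat a ** mat b = (mat (a * b) :: 'a::comm_semiring_1 ^ 'n ^ 'n)"
  unfolding mat_mult_left by (simp add: vec_eq_iff mat_def)

lemma det_mat: "det (mat c :: 'a::comm_ring_1 ^ 'n ^ 'n) = c ^ CARD('n)"
  by (subst det_diagonal) (simp_all add: mat_def)

lemma span_singleton_in_proj_space:
  "v \<noteq> 0 \<Longrightarrow> vec.span {v} \<in> proj_space"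
  by (simp add: proj_space_def)

lemma proj_spaceE:
  assumes "V \<in> proj_space"
  obtains v where "v \<noteq> 0" and "V = vec.span {v}"
proof -
  from assms have V: "vec.subspace V" "vec.dim V = 1" by (auto simp: proj_space_def)
  obtain B where B: "B \<subseteq> V" "vec.independent B" "V \<subseteq> vec.span B" "card B = vec.dim V"
    using vec.basis_exists by blast
  then obtain v where "B = {v}" using V(2) card_1_singletonE by metis
  moreover from this have "v \<noteq> 0" using B(2) vec.dependent_zero by blast
  moreover have "vec.span B = V" using V(1) B(1,3) by (simp add: subset_antisym vec.span_minimal)
  ultimately show thesis using that by metis
qed

lemma image_span_singleton: "(*v) A ` vec.span {v} = vec.span {A *v v}"
  for A :: "'a::field ^ 'n ^ 'm"
  by (simp add: vec.span_singleton image_image vector_scalar_commute)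

lemma span_singleton_eqE:
  fixes u v :: "'a::field ^ 'n"
  assumes "vec.span {u} = vec.span {v}"
  obtains c where "u = c *s v"
proof -
  have "u \<in> vec.span {v}" using assms vec.span_base[of u "{u}"] by simp
  thus thesis using that by (auto simp: vec.span_singleton)
qed

text \<open>A nonzero scalar is absorbed by the subspace. This is what makes the action of a coset
  of scalar matrices well defined.\<close>

lemma image_mat_mult:
  fixes A :: "'a::field ^ 'n ^ 'm"
  assumes "vec.subspace V" and c: "c \<noteq> 0"
  shows "(*v) (mat c ** A) ` V = (*v) A ` V"
proof (intro equalityI subsetI)
  fix x
  show "x \<in> (*v) A ` V" if "x \<in> (*v) (mat c ** A) ` V"
  proof -
    from that obtain v where v: "v \<in> V" "x = c *s (A *v v)" by (auto simp: mat_mult_mv)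
    hence "x = A *v (c *s v)" by (simp add: vector_scalar_commute)
    thus ?thesis using v vec.subspace_scale[OF \<open>vec.subspace V\<close>] by blast
  qed
  show "x \<in> (*v) (mat c ** A) ` V" if "x \<in> (*v) A ` V"
  proof -
    from that obtain v where v: "v \<in> V" "x = A *v v" by auto
    hence "x = (mat c ** A) *v (inverse c *s v)"
      using c by (simp add: mat_mult_mv vector_scalar_commute)
    thus ?thesis using v vec.subspace_scale[OF \<open>vec.subspace V\<close>] by blast
  qed
qed

section \<open>The Singer cycle\<close>

text \<open>\<open>R\<close> consists of the multiplications by nonzero elements of the extension
  field, carried over to matrices by \<open>T\<close>. Cancelling a nonzero field element turns
  proportionality at one vector into proportionality of the matrices, which later becomes equality
  of their cosets.\<close>

lemma singer_family:
  assumes "primepow CARD('a::{field,finite})"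
  obtains R :: "('a::{field,finite} ^ 'n::finite ^ 'n) set" and v\<^sub>0
  where "v\<^sub>0 \<noteq> 0" and "\<And>A. A \<in> R \<Longrightarrow> invertible A"
    and "\<And>v. v \<noteq> 0 \<Longrightarrow> \<exists>A\<in>R. A *v v\<^sub>0 = v"
    and "\<And>A B v c. \<lbrakk>A \<in> R; B \<in> R; v \<noteq> 0; A *v v = c *s (B *v v)\<rbrakk> \<Longrightarrow> A = mat c ** B"
proof -
  obtain T :: "'a ^ 'n \<Rightarrow> 'a alg_closure"
    where T: "\<And>u v. T (u + v) = T u + T v" "\<And>c v. T (c *s v) = to_ac c * T v" "inj T"
      "range T = {x. x ^ (CARD('a) ^ CARD('n)) = x}"
    by (rule vec_iso_extension_field[OF assms, where 'n = 'n]) (rule that)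
  have T0: "T v = 0 \<longleftrightarrow> v = 0" for v
    using T(2)[of 0 0] inj_eq[OF T(3), of v 0] by simp
  have mult: "x * y \<in> range T" if "x \<in> range T" "y \<in> range T" for x y
    using that unfolding T(4) by (simp add: power_mult_distrib)
  define M :: "'a ^ 'n \<Rightarrow> 'a ^ 'n ^ 'n"
    where "M u = matrix (\<lambda>v. inv_into UNIV T (T u * T v))" for u
  \<comment> \<open>The range of \<open>T\<close> is closed under products, so
    \<open>inv_into\<close> returns a genuine preimage here.\<close>
  have T_inv: "T (inv_into UNIV T (T u * T v)) = T u * T v" for u v
    using mult[of "T u" "T v"] by (intro f_inv_into_f) auto
  have "Vector_Spaces.linear (*s) (*s) (\<lambda>v. inv_into UNIV T (T u * T v))" for u
  proof (rule Vector_Spaces.linear_iff[THEN iffD2], intro conjI allI)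
    show "vector_space ((*s) :: 'a \<Rightarrow> 'a ^ 'n \<Rightarrow> 'a ^ 'n)" by (rule vec.vector_space_axioms)
    thus "vector_space ((*s) :: 'a \<Rightarrow> 'a ^ 'n \<Rightarrow> 'a ^ 'n)" .
    show "inv_into UNIV T (T u * T (v + w)) = inv_into UNIV T (T u * T v) + inv_into UNIV T (T u * T w)" for v w
      by (rule injD[OF T(3)]) (metis T(1) T_inv distrib_left)
    show "inv_into UNIV T (T u * T (c *s v)) = c *s inv_into UNIV T (T u * T v)" for c v
      by (rule injD[OF T(3)]) (metis T(2) T_inv mult.left_commute)
  qed
  hence "M u *v v = inv_into UNIV T (T u * T v)" for u v
    unfolding M_def by (rule matrix_works)
  hence TM: "T (M u *v v) = T u * T v" for u v
    by (simp add: T_inv)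
  \<comment> \<open>The base vector represents the field element 1, so \<open>M u\<close> sends it
    to \<open>u\<close>.\<close>
  have "1 \<in> range T" unfolding T(4) by simp
  then obtain v\<^sub>0 where v0: "T v\<^sub>0 = 1" by auto
  show thesis
  proof (rule that[of v\<^sub>0 "M ` (- {0})"])
    show "v\<^sub>0 \<noteq> 0" using v0 T0[of v\<^sub>0] by (metis zero_neq_one)
    show "invertible A" if "A \<in> M ` (- {0})" for A
    proof -
      from that obtain u where u: "A = M u" "u \<noteq> 0" by auto
      \<comment> \<open>The kernel is trivial because a field has no zero divisors.\<close>
      have "v = 0" if "A *v v = 0" for v
        using TM[of u v] that u T0 by (metis mult_eq_0_iff)
      thus ?thesis
        by (simp add: invertible_left_inverse matrix_left_invertible_ker)
    qed
    show "\<exists>A\<in>M ` (- {0}). A *v v\<^sub>0 = v" if "v \<noteq> 0" for v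
      using that TM[of v v\<^sub>0] v0 T(3) by (auto simp: inj_eq)
    show "A = mat c ** B"
      if AB: "A \<in> M ` (- {0})" "B \<in> M ` (- {0})" "v \<noteq> 0" "A *v v = c *s (B *v v)" for A B v c
    proof -
      from AB obtain a b where ab: "A = M a" "B = M b" by auto
      have "T a * T v = to_ac c * T b * T v"
        using TM[of a v] TM[of b v] T(2)[of c "B *v v"] AB(4) ab by (metis mult.assoc)
      hence "T a = to_ac c * T b" using T0 \<open>v \<noteq> 0\<close> by simp
      hence "T (A *v w) = T ((mat c ** B) *v w)" for w
        by (simp add: ab TM T(2) mat_mult_mv)
      thus ?thesis
        unfolding matrix_eq using T(3) by (simp add: inj_eq)
    qed
  qed
qed

section \<open>Sharply transitive sets\<close>

text \<open>This is a clique-coclique bound: distinct elements of \<open>R\<close> agree nowhere,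
  whereas any two elements of \<open>S\<close> agree somewhere, so multiplication is injective on
  \<open>S \<times> R\<close>.\<close>

lemma (in group_action) weak_EKR_if_sharply_transitive_set:
  assumes fin: "finite (carrier G)" "finite E" and R: "R \<subseteq> carrier G"
    and sharp: "\<And>r s x. \<lbrakk>r \<in> R; s \<in> R; x \<in> E; \<phi> r x = \<phi> s x\<rbrakk> \<Longrightarrow> r = s"
    and x0: "x\<^sub>0 \<in> E" "\<And>y. y \<in> E \<Longrightarrow> \<exists>r\<in>R. \<phi> r x\<^sub>0 = y"
  shows "weak_EKR G E \<phi>"
proof -
  interpret group G using group_hom by (rule group_hom.axioms)
  have mult: "\<phi> (g \<otimes> h) x = \<phi> g (\<phi> h x)" if "g \<in> carrier G" "h \<in> carrier G" "x \<in> E" for g h x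
    using composition_rule[OF that(3,1,2)] .
  have inv: "\<phi> (inv g) y = x" if "g \<in> carrier G" "x \<in> E" "\<phi> g x = y" for g x y
    using orbit_sym_aux[OF that] .
  have closed: "\<phi> g x \<in> E" if "g \<in> carrier G" "x \<in> E" for g x
    using element_image[OF that] by blast
  have "transitive_action G E \<phi>"
  proof
    fix x y assume "x \<in> E" "y \<in> E"
    \<comment> \<open>Any two points are connected through the base point
      \<open>x\<^sub>0\<close>.\<close>
    then obtain r s where rs: "r \<in> R" "s \<in> R" "\<phi> r x\<^sub>0 = x" "\<phi> s x\<^sub>0 = y"
      using x0(2) by meson
    moreover from this have "r \<in> carrier G" "s \<in> carrier G" using R by auto
    ultimately have "\<phi> (s \<otimes> inv r) x = y"
      using x0(1) \<open>x \<in> E\<close> inv[of r x\<^sub>0 x] mult[of s "inv r" x] by auto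
    moreover have "s \<otimes> inv r \<in> carrier G"
      using \<open>r \<in> carrier G\<close> \<open>s \<in> carrier G\<close> by simp
    ultimately show "\<exists>g\<in>carrier G. \<phi> g x = y" by blast
  qed
  moreover have "card S \<le> order G / card E" if S: "intersecting G E \<phi> S" for S
  proof -
    \<comment> \<open>Evaluation at the base point identifies \<open>R\<close> with
      \<open>E\<close>, so both have the same size.\<close>
    have "bij_betw (\<lambda>r. \<phi> r x\<^sub>0) R E"
    proof (rule bij_betw_imageI)
      show "inj_on (\<lambda>r. \<phi> r x\<^sub>0) R" using sharp x0(1) by (meson inj_onI)
      show "(\<lambda>r. \<phi> r x\<^sub>0) ` R = E" using closed x0 R by blast
    qed
    hence card_R: "card R = card E" by (rule bij_betw_same_card)
    have S_G: "S \<subseteq> carrier G" using S by (simp add: intersecting_def)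
    have "inj_on (\<lambda>(s, r). s \<otimes> r) (S \<times> R)"
    proof (rule inj_onI, clarify)
      fix s r s' r' assume *: "s \<in> S" "r \<in> R" "s' \<in> S" "r' \<in> R" "s \<otimes> r = s' \<otimes> r'"
      then obtain x where x: "x \<in> E" "\<phi> s x = \<phi> s' x"
        using S unfolding intersecting_def by blast
      have G: "s \<in> carrier G" "r \<in> carrier G" "s' \<in> carrier G" "r' \<in> carrier G"
        using * R S_G by auto
      \<comment> \<open>At this point \<open>s \<otimes> r\<close> takes the value on which
        \<open>s\<close> and \<open>s'\<close> agree. Cancelling \<open>s'\<close> shows that
        \<open>r\<close> and \<open>r'\<close> agree at \<open>y\<close>, so sharpness
        applies.\<close>
      define y where "y = \<phi> (inv r) x"
      have y: "y \<in> E" "\<phi> r y = x"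
        using G x(1) closed[of "inv r" x] inv[of "inv r" x y] by (auto simp: y_def)
      have "\<phi> s' (\<phi> r' y) = \<phi> s' x"
        using *(5) mult[of s r y] mult[of s' r' y] G x(2) y by simp
      hence "\<phi> r' y = x"
        using G inj_prop[of s'] closed[of r' y] x(1) y(1) by (meson inj_onD)
      hence "r = r'" using sharp *(2,4) y by metis
      thus "s = s' \<and> r = r'" using G *(5) by simp
    qed
    moreover have "(\<lambda>(s, r). s \<otimes> r) ` (S \<times> R) \<subseteq> carrier G"
      using S_G R by auto
    ultimately have "card (S \<times> R) \<le> order G"
      unfolding order_def using fin(1) card_inj_on_le by blast
    hence "real (card S) * real (card E) \<le> real (order G)"
      by (simp add: card_cartesian_product card_R flip: of_nat_mult)
    moreover have "card E > 0" using x0(1) fin(2) card_gt_0_iff by blast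
    ultimately show ?thesis by (simp add: field_simps)
  qed
  ultimately show ?thesis unfolding weak_EKR_def using fin by blast
qed

section \<open>The projective action of a linear group\<close>

lemma group_GL: "group GL"
proof (rule groupI)
  fix A :: "'a ^ 'n ^ 'n" assume "A \<in> carrier GL"
  then obtain B where "A ** B = mat 1" "B ** A = mat 1"
    by (auto simp: GL_def invertible_def)
  thus "\<exists>B\<in>carrier GL. B \<otimes>\<^bsub>GL\<^esub> A = \<one>\<^bsub>GL\<^esub>"
    by (auto simp: GL_def invertible_def)
next
  show "\<one>\<^bsub>GL\<^esub> \<in> carrier (GL :: ('a ^ 'n ^ 'n) monoid)"
    unfolding GL_def invertible_def using matrix_mul_lid by auto
qed (simp_all add: GL_def invertible_mult matrix_mul_assoc)

text \<open>A common setting for GL and SL: the quotient of \<open>H\<close> by its scalar matrices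
  specialises to both projective groups.\<close>

locale linear_group =
  fixes H :: "('a::{field,finite} ^ 'n::finite ^ 'n) set"
  assumes subgroup_GL: "subgroup H GL"
begin

definition G :: "('a ^ 'n ^ 'n) monoid" where "G = GL\<lparr>carrier := H\<rparr>"

definition Z :: "('a ^ 'n ^ 'n) set" where "Z = scalars \<inter> H"

lemma carrier_G [simp]: "carrier G = H"
  and mult_G [simp]: "A \<otimes>\<^bsub>G\<^esub> B = A ** B"
  and one_G [simp]: "\<one>\<^bsub>G\<^esub> = mat 1"
  by (simp_all add: G_def GL_def)

sublocale group G
  unfolding G_def using subgroup_GL group_GL by (rule group.subgroup_imp_group[rotated])

lemma invertible_if_mem: "A \<in> H \<Longrightarrow> invertible A"
  using subgroup.subset[OF subgroup_GL] by (auto simp: GL_def)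

lemma mult_mem: "A \<in> H \<Longrightarrow> B \<in> H \<Longrightarrow> A ** B \<in> H"
  using m_closed[of A B] by simp

lemma inv_mem: "A \<in> H \<Longrightarrow> inv\<^bsub>G\<^esub> A \<in> H"
  using inv_closed[of A] by simp

lemma inv_right: "A \<in> H \<Longrightarrow> A ** inv\<^bsub>G\<^esub> A = mat 1"
  using r_inv[of A] by simp

lemma inv_left: "A \<in> H \<Longrightarrow> inv\<^bsub>G\<^esub> A ** A = mat 1"
  using l_inv[of A] by simp

text \<open>Scalar matrices commute with every matrix, so left and right cosets coincide.\<close>

lemma normal_Z: "Z \<lhd> G"
proof (rule normalI)
  show "subgroup Z G"
  proof (rule subgroupI)
    show "Z \<subseteq> carrier G" by (auto simp: Z_def)
    have "mat 1 \<in> Z"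
      using one_closed unfolding Z_def scalars_def by (auto intro!: exI[of _ 1])
    thus "Z \<noteq> {}" by blast
  next
    fix A assume A: "A \<in> Z"
    then obtain c where c: "A = mat c" "c \<noteq> 0" "A \<in> H" by (auto simp: Z_def scalars_def)
    have "inv\<^bsub>G\<^esub> A ** (A ** mat (inverse c)) = mat (inverse c)"
      using c by (simp only: matrix_mul_assoc inv_left matrix_mul_lid)
    hence "inv\<^bsub>G\<^esub> A = mat (inverse c)"
      using c by (simp add: mat_mult_mat)
    moreover have "inv\<^bsub>G\<^esub> A \<in> H" using c(3) by (rule inv_mem)
    ultimately show "inv\<^bsub>G\<^esub> A \<in> Z"
      using c(2) by (auto simp: Z_def scalars_def)
  next
    fix A B assume "A \<in> Z" "B \<in> Z"
    thus "A \<otimes>\<^bsub>G\<^esub> B \<in> Z"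
      using mult_mem[of A B] by (auto simp: Z_def scalars_def mat_mult_mat)
  qed
  show "\<forall>A\<in>carrier G. Z #>\<^bsub>G\<^esub> A = A <#\<^bsub>G\<^esub> Z"
    unfolding r_coset_def l_coset_def by (auto simp: Z_def scalars_def mat_mult_right)
qed

sublocale normal Z G by (rule normal_Z)

text \<open>All representatives of the coset are nonzero scalar multiples of \<open>A\<close>, so
  the set handed to \<open>the_elem\<close> is a singleton.\<close>

lemma proj_action_coset:
  assumes "A \<in> H" "V \<in> proj_space"
  shows "proj_action (Z #>\<^bsub>G\<^esub> A) V = (*v) A ` V"
proof -
  have V: "vec.subspace V" using assms(2) by (simp add: proj_space_def)
  have "(*v) B ` V = (*v) A ` V" if "B \<in> Z #>\<^bsub>G\<^esub> A" for B
  proof -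
    from that obtain c where "c \<noteq> 0" "B = mat c ** A"
      by (auto simp: r_coset_def Z_def scalars_def)
    thus ?thesis using image_mat_mult[OF V] by simp
  qed
  moreover have "A \<in> Z #>\<^bsub>G\<^esub> A" using rcos_self[of A] assms(1) is_subgroup by simp
  ultimately have "(\<lambda>B. (*v) B ` V) ` (Z #>\<^bsub>G\<^esub> A) = {(*v) A ` V}" by blast
  thus ?thesis using assms(2) by (simp add: proj_action_def)
qed

lemma image_in_proj_space:
  assumes "A \<in> H" "V \<in> proj_space"
  shows "(*v) A ` V \<in> proj_space"
proof -
  obtain v where v: "v \<noteq> 0" "V = vec.span {v}" using proj_spaceE[OF assms(2)] .
  have "A *v v \<noteq> 0"
  proof
    assume "A *v v = 0"
    hence "(inv\<^bsub>G\<^esub> A ** A) *v v = 0"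
      by (simp add: matrix_vector_mul_assoc[symmetric])
    thus False using v(1) inv_left[OF assms(1)] by simp
  qed
  thus ?thesis by (simp add: v(2) image_span_singleton span_singleton_in_proj_space)
qed

lemma proj_action_extensional: "proj_action C \<in> extensional proj_space"
  by (simp add: proj_action_def)

lemma group_action_proj: "group_action (G Mod Z) proj_space proj_action"
proof (intro group_action.intro group_hom.intro group_hom_axioms.intro homI)
  show "group (G Mod Z)" by (rule factorgroup_is_group)
  show "group (BijGroup proj_space)" by (rule group_BijGroup)
  have Bij: "proj_action C \<in> Bij proj_space" if "C \<in> carrier (G Mod Z)" for C
  proof -
    from that obtain A where A: "A \<in> H" "C = Z #>\<^bsub>G\<^esub> A"
      by (auto simp: carrier_FactGroup)
    have A': "inv\<^bsub>G\<^esub> A \<in> H" using A(1) by (rule inv_mem)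
    have "bij_betw (proj_action C) proj_space proj_space"
    \<comment> \<open>The inverse map comes from the inverse of the representative
      \<open>A\<close>.\<close>
    proof (rule bij_betw_byWitness[where f' = "image ((*v) (inv\<^bsub>G\<^esub> A))"])
      show "\<forall>V\<in>proj_space. (*v) (inv\<^bsub>G\<^esub> A) ` proj_action C V = V"
        using A by (simp add: proj_action_coset image_image matrix_vector_mul_assoc inv_left)
      show "\<forall>V\<in>proj_space. proj_action C ((*v) (inv\<^bsub>G\<^esub> A) ` V) = V"
        using A A' by (simp add: proj_action_coset image_in_proj_space image_image
            matrix_vector_mul_assoc inv_right)
    qed (use A A' in \<open>auto simp: proj_action_coset image_in_proj_space\<close>)
    thus ?thesis by (simp add: Bij_def proj_action_extensional)
  qed
  thus "proj_action C \<in> carrier (BijGroup proj_space)" if "C \<in> carrier (G Mod Z)" for C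
    using that by (simp add: BijGroup_def)
  fix C D assume CD: "C \<in> carrier (G Mod Z)" "D \<in> carrier (G Mod Z)"
  then obtain A B where AB: "A \<in> H" "C = Z #>\<^bsub>G\<^esub> A" "B \<in> H" "D = Z #>\<^bsub>G\<^esub> B"
    by (auto simp: carrier_FactGroup)
  have "C \<otimes>\<^bsub>G Mod Z\<^esub> D = Z #>\<^bsub>G\<^esub> (A ** B)"
    using AB rcos_sum[of A B] by simp
  moreover have "A ** B \<in> H" using AB by (simp add: mult_mem)
  \<comment> \<open>Both sides are extensional on \<open>proj_space\<close>, so comparing them on
    lines suffices.\<close>
  ultimately have "proj_action (C \<otimes>\<^bsub>G Mod Z\<^esub> D) = compose proj_space (proj_action C) (proj_action D)"
    using AB by (intro extensionalityI[OF proj_action_extensional compose_extensional])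
      (simp add: compose_eq proj_action_coset image_in_proj_space image_image matrix_vector_mul_assoc)
  thus "proj_action (C \<otimes>\<^bsub>G Mod Z\<^esub> D)
      = proj_action C \<otimes>\<^bsub>BijGroup proj_space\<^esub> proj_action D"
    using CD Bij by (simp add: BijGroup_def)
qed

text \<open>The scalar matrix equals \<open>A\<close> times the inverse of \<open>B\<close>; this
  places it in \<open>H\<close> and thereby forces \<open>c\<close> to be nonzero.\<close>

lemma coset_eqI:
  assumes "A \<in> H" "B \<in> H" "A = mat c ** B"
  shows "Z #>\<^bsub>G\<^esub> A = Z #>\<^bsub>G\<^esub> B"
proof -
  have "mat c = A ** inv\<^bsub>G\<^esub> B"
    using assms(2) by (simp only: assms(3) matrix_mul_assoc[symmetric] inv_right matrix_mul_rid)
  hence "mat c \<in> H"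
    using mult_mem inv_mem assms(1,2) by simp
  moreover have "c \<noteq> 0"
  proof
    assume "c = 0"
    \<comment> \<open>The determinant is 0 to the power n, which vanishes since index types are
      nonempty.\<close>
    have "det (mat 0 :: 'a ^ 'n ^ 'n) = 0" unfolding det_mat by simp
    hence "\<not> invertible (mat 0 :: 'a ^ 'n ^ 'n)" using invertible_det_nz by blast
    thus False using \<open>c = 0\<close> \<open>mat c \<in> H\<close> invertible_if_mem by blast
  qed
  ultimately have "mat c \<in> Z" by (auto simp: Z_def scalars_def)
  hence "A \<in> Z #>\<^bsub>G\<^esub> B" by (auto simp: r_coset_def assms(3))
  thus ?thesis using repr_independence[of A Z B] assms(2) is_subgroup by simp
qed

text \<open>The Singer family need not lie in \<open>H\<close>, but \<open>scale\<close> ensures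
  that its members inside \<open>H\<close> still reach every line. Their cosets then form the
  sharply transitive set.\<close>

lemma weak_EKR_proj:
  assumes "primepow CARD('a)"
    and scale: "\<And>A. invertible A \<Longrightarrow> \<exists>c. c \<noteq> 0 \<and> mat c ** A \<in> H"
  shows "weak_EKR (G Mod Z) proj_space proj_action"
proof -
  obtain R :: "('a ^ 'n ^ 'n) set" and v\<^sub>0
    where v0: "v\<^sub>0 \<noteq> 0" and inv: "\<And>A. A \<in> R \<Longrightarrow> invertible A"
      and onto: "\<And>v. v \<noteq> 0 \<Longrightarrow> \<exists>A\<in>R. A *v v\<^sub>0 = v"
      and sharp: "\<And>A B v c. \<lbrakk>A \<in> R; B \<in> R; v \<noteq> 0; A *v v = c *s (B *v v)\<rbrakk> \<Longrightarrow> A = mat c ** B"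
    by (rule singer_family[OF assms(1), where 'n = 'n]) (rule that)
  show ?thesis
  proof (rule group_action.weak_EKR_if_sharply_transitive_set[OF group_action_proj])
    show "finite (carrier (G Mod Z))" by (simp add: carrier_FactGroup)
    show "finite (proj_space :: ('a ^ 'n) set set)" by simp
    show "(\<lambda>A. Z #>\<^bsub>G\<^esub> A) ` (R \<inter> H) \<subseteq> carrier (G Mod Z)"
      by (auto simp: carrier_FactGroup)
    show "vec.span {v\<^sub>0} \<in> proj_space" using v0 by (rule span_singleton_in_proj_space)
  next
    fix C D V
    assume *: "C \<in> (\<lambda>A. Z #>\<^bsub>G\<^esub> A) ` (R \<inter> H)" "D \<in> (\<lambda>A. Z #>\<^bsub>G\<^esub> A) ` (R \<inter> H)"
      "V \<in> proj_space" "proj_action C V = proj_action D V"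
    then obtain A B where AB: "A \<in> R" "A \<in> H" "C = Z #>\<^bsub>G\<^esub> A" "B \<in> R" "B \<in> H" "D = Z #>\<^bsub>G\<^esub> B"
      by blast
    obtain v where v: "v \<noteq> 0" "V = vec.span {v}" using proj_spaceE[OF *(3)] .
    have "vec.span {A *v v} = vec.span {B *v v}"
      using *(3,4) AB by (simp add: proj_action_coset v(2) image_span_singleton)
    then obtain c where "A *v v = c *s (B *v v)" by (rule span_singleton_eqE)
    hence "A = mat c ** B" using sharp AB v(1) by blast
    thus "C = D" using coset_eqI AB by simp
  next
    fix V :: "('a ^ 'n) set" assume "V \<in> proj_space"
    then obtain v where v: "v \<noteq> 0" "V = vec.span {v}" by (rule proj_spaceE)
    obtain A where A: "A \<in> R" "A *v v\<^sub>0 = v" using onto[OF v(1)] by blast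
    obtain c where c: "c \<noteq> 0" "mat c ** A \<in> H" using scale inv A(1) by blast
    have "c *s v \<noteq> 0" using c(1) v(1) by simp
    \<comment> \<open>The scaled matrix \<open>mat c ** A\<close> lies in \<open>H\<close>.
      Sharpness at \<open>v\<^sub>0\<close> identifies it with \<open>B\<close>, so it also lies in
      \<open>R\<close>.\<close>
    then obtain B where B: "B \<in> R" "B *v v\<^sub>0 = c *s v" using onto by blast
    hence "B = mat c ** A" using sharp[OF B(1) A(1) v0] A(2) by simp
    hence "B \<in> H" using c(2) by simp
    moreover have "proj_action (Z #>\<^bsub>G\<^esub> B) (vec.span {v\<^sub>0}) = V"
    proof -
      have "proj_action (Z #>\<^bsub>G\<^esub> B) (vec.span {v\<^sub>0}) = (*v) (mat c ** A) ` vec.span {v\<^sub>0}"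
        using \<open>B \<in> H\<close> \<open>B = mat c ** A\<close> span_singleton_in_proj_space[OF v0]
        by (simp add: proj_action_coset)
      also have "\<dots> = V"
        unfolding image_mat_mult[OF vec.subspace_span c(1)]
        by (simp only: image_span_singleton A(2) v(2))
      finally show ?thesis .
    qed
    ultimately show "\<exists>C\<in>(\<lambda>A. Z #>\<^bsub>G\<^esub> A) ` (R \<inter> H). proj_action C (vec.span {v\<^sub>0}) = V"
      using B(1) by blast
  qed
qed

end

section \<open>Specialisation to the projective general and special linear groups\<close>

theorem theorem4:
  fixes q n :: nat
  assumes "primepow q" and "CARD('a::{field,finite}) = q"
    and "n > 0" and "CARD('n::finite) = n"
  shows "weak_EKR (PGL :: ('a ^ 'n ^ 'n) set monoid) proj_space proj_action \<and>
         (gcd n (q - 1) = 1 \<longrightarrow>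
            weak_EKR (PSL :: ('a ^ 'n ^ 'n) set monoid) proj_space proj_action)"
proof (intro conjI impI)
  let ?GL = "GL :: ('a ^ 'n ^ 'n) monoid"
  have primepow: "primepow CARD('a)" using assms(1,2) by simp
  interpret GL: group ?GL by (rule group_GL)
  interpret PGL: linear_group "carrier ?GL"
    by (rule linear_group.intro) (rule GL.subgroup_self)
  have "scalars \<subseteq> carrier ?GL"
    by (auto simp: scalars_def GL_def invertible_det_nz det_mat)
  hence "PGL.G Mod PGL.Z = PGL"
    by (simp add: PGL.G_def PGL.Z_def PGL_def Int_absorb2)
  moreover have "\<exists>c. c \<noteq> 0 \<and> mat c ** A \<in> carrier ?GL" if "invertible A" for A
    using that by (intro exI[of _ 1]) (simp add: GL_def)
  ultimately show "weak_EKR (PGL :: ('a ^ 'n ^ 'n) set monoid) proj_space proj_action"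
    using PGL.weak_EKR_proj[OF primepow] by simp

  assume gcd: "gcd n (q - 1) = 1"
  have SL: "carrier (SL :: ('a ^ 'n ^ 'n) monoid) = {A \<in> carrier ?GL. det A = 1}"
    by (simp add: SL_def)
  interpret PSL: linear_group "carrier (SL :: ('a ^ 'n ^ 'n) monoid)"
  proof (rule linear_group.intro, rule GL.subgroupI)
    show "carrier (SL :: ('a ^ 'n ^ 'n) monoid) \<noteq> {}"
      using GL.one_closed unfolding SL by (auto simp: GL_def intro!: exI[of _ "mat 1"])
  next
    fix A assume A: "A \<in> carrier (SL :: ('a ^ 'n ^ 'n) monoid)"
    hence "det (A ** inv\<^bsub>?GL\<^esub> A) = 1"
      using GL.r_inv[of A] unfolding SL by (simp add: GL_def)
    thus "inv\<^bsub>?GL\<^esub> A \<in> carrier SL"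
      using A unfolding SL by (simp add: det_mul)
  next
    fix A B assume "A \<in> carrier (SL :: ('a ^ 'n ^ 'n) monoid)" "B \<in> carrier (SL :: ('a ^ 'n ^ 'n) monoid)"
    thus "A \<otimes>\<^bsub>?GL\<^esub> B \<in> carrier SL"
      unfolding SL by (auto simp: GL_def invertible_mult det_mul)
  qed (auto simp: SL)
  have "PSL.G Mod PSL.Z = PSL"
    by (simp add: PSL.G_def PSL.Z_def PSL_def) (simp add: SL_def)
  moreover have "\<exists>c. c \<noteq> 0 \<and> mat c ** A \<in> carrier SL" if "invertible A" for A :: "'a ^ 'n ^ 'n"
  proof -
    have "det A \<noteq> 0" using that by (simp add: invertible_det_nz)
    \<comment> \<open>Coprimality yields an inverse \<open>x\<close> of n modulo q - 1. Since
      nonzero elements have (q - 1)-st power 1, the \<open>x\<close>-th power of the inverse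
      determinant is an n-th root of it. Scaling by \<open>c\<close> multiplies the determinant by
      \<open>c ^ n\<close> and so makes it 1.\<close>
    obtain x y where xy: "n * x = (q - 1) * y + 1"
      using bezout_nat[of n "q - 1"] gcd assms(3) by auto
    define c where "c = inverse (det A) ^ x"
    have c: "c \<noteq> 0" using \<open>det A \<noteq> 0\<close> by (simp add: c_def)
    have "b ^ (q - 1) = 1" if "b \<noteq> 0" for b :: 'a
      using power_CARD_minus_1_eq_1[OF that] assms(2) by simp
    hence "inverse (det A) ^ ((q - 1) * y + 1) = inverse (det A)"
      using \<open>det A \<noteq> 0\<close> by (simp add: power_mult)
    hence "c ^ n = inverse (det A)"
      unfolding c_def by (simp only: power_mult[symmetric] mult.commute[of x n] xy)
    hence "det (mat c ** A) = 1"
      using \<open>det A \<noteq> 0\<close> assms(4) by (simp add: det_mul det_mat)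
    thus ?thesis
      using c by (intro exI[of _ c]) (simp add: SL GL_def invertible_det_nz)
  qed
  ultimately show "weak_EKR (PSL :: ('a ^ 'n ^ 'n) set monoid) proj_space proj_action"
    using PSL.weak_EKR_proj[OF primepow] by simp
qed

end
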